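(* Let $n\ge 0$ and let $Z_n$ be the number of zeros of a random lattice path $W_n$ of length $n$ (as described in the context). Then $\mathbb{E}[Z_n]=H^{\mathrm{odd}}_{n+1}$, where $H^{\mathrm{odd}}_m=\sum_{j=1}^m\frac{[j\text{ odd}]}{j}$.
   Context: Random lattice path model: a path $W_n$ of length $n$ starts at $(0,0)$ and uses steps $(1,+1)$ and $(1,-1)$. First an endpoint $(n,D)$ is chosen with $D$ uniformly distributed on $\{-n,-n+2,\dots,n-2,n\}$; then a path is chosen uniformly at random among all paths from $(0,0)$ to $(n,D)$. A zero of the path is a point $(x,0)$ on it (including the origin). $[P]=1$ if $P$ is true and $0$ otherwise. *)

theory Defs
  imports "HOL-Probability.Probability"
begin

text \<open>A path is represented by its list of steps, each a vector in the integer lattice;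
  sums of pairs are componentwise.\<close>

definition lattice_paths :: "nat \<Rightarrow> int \<Rightarrow> (int \<times> int) list set" where
  "lattice_paths n D =
     {w. length w = n \<and> set w \<subseteq> {(1, 1), (1, -1)} \<and> sum_list w = (int n, D)}"

definition path_points :: "(int \<times> int) list \<Rightarrow> (int \<times> int) set" where
  "path_points w = {sum_list (take k w) | k. k \<le> length w}"

definition num_zeros :: "(int \<times> int) list \<Rightarrow> nat" where
  "num_zeros w = card {x. (x, 0) \<in> path_points w}"

definition endpoint_heights :: "nat \<Rightarrow> int set" where
  "endpoint_heights n = {- int n + 2 * int k | k. k \<le> n}"

definition random_path :: "nat \<Rightarrow> (int \<times> int) list pmf" where
  "random_path n = bind_pmf (pmf_of_set (endpoint_heights n)) (\<lambda>D. pmf_of_set (lattice_paths n D))"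

definition H_odd :: "nat \<Rightarrow> real" where
  "H_odd m = (\<Sum>j = 1..m. of_bool (odd j) / real j)"

text \<open>\<^const>\<open>pmf_of_set\<close> is meaningful only for finite nonempty sets; both uses above are
  of this kind.\<close>

lemma endpoint_heights_finite_nonempty:
  "finite (endpoint_heights n)" "endpoint_heights n \<noteq> {}"
  by (auto simp: endpoint_heights_def)

lemma lattice_paths_finite: "finite (lattice_paths n D)"
proof (rule finite_subset)
  show "lattice_paths n D \<subseteq> {w. set w \<subseteq> {(1, 1), (1, -1)} \<and> length w = n}"
    by (auto simp: lattice_paths_def)
qed (simp add: finite_lists_length_eq)

lemma lattice_paths_nonempty:
  assumes "D \<in> endpoint_heights n"
  shows "lattice_paths n D \<noteq> {}"
proof -
  obtain k where k: "k \<le> n" "D = - int n + 2 * int k"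
    using assms by (auto simp: endpoint_heights_def)
  have rep: "sum_list (replicate m (1, a)) = (int m, int m * a)" for m and a :: int
    by (induction m) (simp_all add: zero_prod_def algebra_simps)
  have "replicate k (1, 1) @ replicate (n - k) (1, -1) \<in> lattice_paths n D"
    using k by (auto simp: lattice_paths_def rep of_nat_diff)
  then show ?thesis by blast
qed

end

theory Submission
  imports Defs
begin

text \<open>A path of length \<open>n\<close> with \<open>k\<close> up-steps has probability \<open>1 / ((n + 1) * (n choose k))\<close>, and
  these weights are consistent in \<open>n\<close> (as for Polya's urn): deleting the last step of \<open>W\<^bsub>n+1\<^esub>\<close>
  yields \<open>W\<^bsub>n\<^esub>\<close> in distribution. Hence passing from \<open>n\<close> to \<open>n + 1\<close> adds to the expected
  number of zeros exactly the probability that \<open>W\<^bsub>n+1\<^esub>\<close> ends at height \<open>0\<close>, which is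
  \<open>1 / (n + 2)\<close> for even \<open>n + 1\<close> and \<open>0\<close> otherwise.\<close>

lemma sum_list_steps:
  fixes w :: "(int \<times> int) list"
  assumes "set w \<subseteq> {(1, 1), (1, -1)}"
  shows "fst (sum_list w) = int (length w)" "\<bar>snd (sum_list w)\<bar> \<le> int (length w)"
  using assms by (induction w) auto

text \<open>Disposes of the boundary terms that arise when the recursion on the last step asks for
  heights out of reach.\<close>

lemma lattice_paths_outside:
  assumes "\<bar>D\<bar> > int n"
  shows "lattice_paths n D = {}"
  using assms sum_list_steps(2) by (fastforce simp: lattice_paths_def)

lemma lattice_paths_0: "lattice_paths 0 D = (if D = 0 then {[]} else {})"
  by (auto simp: lattice_paths_def zero_prod_def)

text \<open>Splitting off the last step, not the first, fits the later arguments, which delete or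
  append a step at the end of the path.\<close>

lemma lattice_paths_Suc:
  "lattice_paths (Suc n) D =
     (\<lambda>w. w @ [(1, 1)]) ` lattice_paths n (D - 1) \<union>
     (\<lambda>w. w @ [(1, -1)]) ` lattice_paths n (D + 1)" (is "?L = ?R")
proof
  show "?L \<subseteq> ?R"
  proof
    fix w assume w: "w \<in> ?L"
    then obtain v s where v: "w = v @ [s]"
      by (cases w rule: rev_cases) (auto simp: lattice_paths_def)
    have s: "s = (1, 1) \<or> s = (1, -1)" using w by (auto simp: v lattice_paths_def)
    obtain a b where ab: "sum_list v = (a, b)" by fastforce
    show "w \<in> ?R"
      using w s ab by (auto simp: v lattice_paths_def image_iff)
  qed
  show "?R \<subseteq> ?L" by (auto simp: lattice_paths_def)
qed

lemma sum_lattice_paths_Suc: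
  fixes h :: "(int \<times> int) list \<Rightarrow> 'a::comm_monoid_add"
  shows "(\<Sum>w\<in>lattice_paths (Suc n) D. h w) =
     (\<Sum>w\<in>lattice_paths n (D - 1). h (w @ [(1, 1)])) +
     (\<Sum>w\<in>lattice_paths n (D + 1). h (w @ [(1, -1)]))"
  unfolding lattice_paths_Suc
  by (subst sum.union_disjoint) (auto simp: lattice_paths_finite sum.reindex inj_on_def)

text \<open>Height 2k - n means k up-steps, so the split by last step becomes Pascal's rule.\<close>

lemma card_lattice_paths: "card (lattice_paths n (2 * int k - int n)) = n choose k"
proof (induction n arbitrary: k)
  case 0
  show ?case by (cases k) (auto simp: lattice_paths_0)
next
  case (Suc n)
  have *: "card (lattice_paths (Suc n) (2 * int k - int (Suc n))) =
      card (lattice_paths n (2 * (int k - 1) - int n)) + card (lattice_paths n (2 * int k - int n))"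
    unfolding card_eq_sum sum_lattice_paths_Suc by (simp add: algebra_simps)
  show ?case
  proof (cases k)
    case 0
    \<comment> \<open>Here the first summand sits at height -n - 2, which no path of length
      \<open>n\<close> reaches.\<close>
    then show ?thesis using * Suc[of 0] by (simp add: lattice_paths_outside)
  next
    case (Suc j)
    then show ?thesis using * Suc.IH[of j] Suc.IH[of k] by simp
  qed
qed

lemma expectation_random_path:
  fixes h :: "(int \<times> int) list \<Rightarrow> real"
  shows "measure_pmf.expectation (random_path n) h =
    (\<Sum>k\<le>n. (\<Sum>w\<in>lattice_paths n (2 * int k - int n). h w) / real (n choose k)) / real (n + 1)"
proof -
  let ?e = "\<lambda>k. 2 * int k - int n"
  have inj: "inj_on ?e {..n}" by (auto simp: inj_on_def)
  have heights: "endpoint_heights n = ?e ` {..n}"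
    by (auto simp: endpoint_heights_def image_iff)
  have card: "card (endpoint_heights n) = n + 1"
    unfolding heights by (simp add: card_image[OF inj])
  have "measure_pmf.expectation (random_path n) h =
      (\<Sum>D\<in>endpoint_heights n. pmf (pmf_of_set (endpoint_heights n)) D *\<^sub>R
         measure_pmf.expectation (pmf_of_set (lattice_paths n D)) h)"
    unfolding random_path_def
    by (rule pmf_expectation_bind)
      (auto simp: endpoint_heights_finite_nonempty lattice_paths_finite lattice_paths_nonempty)
  also have "\<dots> = (\<Sum>D\<in>endpoint_heights n.
      (\<Sum>w\<in>lattice_paths n D. h w) / real (card (lattice_paths n D)) / real (n + 1))"
    by (intro sum.cong refl)
      (simp add: endpoint_heights_finite_nonempty lattice_paths_finite lattice_paths_nonempty
        integral_pmf_of_set card field_simps)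
  also have "\<dots> = (\<Sum>k\<le>n. (\<Sum>w\<in>lattice_paths n (?e k). h w) / real (n choose k) / real (n + 1))"
    unfolding heights by (simp add: sum.reindex[OF inj] card_lattice_paths)
  finally show ?thesis by (simp add: sum_divide_distrib)
qed

text \<open>The left summands are the probabilities of the two one-step extensions of a path with
  \<open>k\<close> up-steps. By the absorption identities they are (k+1)/(n+2) and (n+1-k)/(n+2)
  times the probability of that path, and these factors add up to 1.\<close>

lemma inverse_binomial_consistency:
  assumes "k \<le> n"
  shows "1 / (real (n + 2) * real (Suc n choose Suc k)) + 1 / (real (n + 2) * real (Suc n choose k)) =
    1 / (real (n + 1) * real (n choose k))"
proof -
  have up: "real (Suc k) * real (Suc n choose Suc k) = real (n + 1) * real (n choose k)"
    using Suc_times_binomial_eq[of n k] by (metis Suc_eq_plus1 mult.commute of_nat_mult)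
  have down: "real (Suc n - k) * real (Suc n choose k) = real (n + 1) * real (n choose k)"
    using binomial_absorb_comp[of "Suc n" k] by (metis Suc_eq_plus1 diff_Suc_1 of_nat_mult)
  let ?b = "real (n + 1) * real (n choose k)"
  have pos: "?b > 0" "real (n + 2) > 0" "real (Suc k) > 0" "real (Suc n - k) > 0"
    using assms by auto
  have "1 / (real (n + 2) * real (Suc n choose Suc k)) = real (Suc k) / (real (n + 2) * ?b)"
    unfolding up[symmetric] using pos by simp
  moreover have "1 / (real (n + 2) * real (Suc n choose k)) = real (Suc n - k) / (real (n + 2) * ?b)"
    unfolding down[symmetric] using pos by simp
  moreover have "real (Suc k) + real (Suc n - k) = real (n + 2)"
    using assms by (simp add: of_nat_diff)
  ultimately show ?thesis
    using pos by (simp add: add_divide_distrib[symmetric])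
qed

lemma expectation_random_path_butlast:
  fixes g :: "(int \<times> int) list \<Rightarrow> real"
  shows "measure_pmf.expectation (random_path (Suc n)) (\<lambda>w. g (butlast w)) =
    measure_pmf.expectation (random_path n) g"
proof -
  \<comment> \<open>An integer argument lets k - 1 take the value -1 at k = 0. The sums at -1 and n
    + 1 are empty, which is what makes both ranges below shrink to k \<le> n.\<close>
  define S where "S = (\<lambda>k::int. \<Sum>w\<in>lattice_paths n (2 * k - int n). g w)"
  have S0: "S (-1) = 0" "S (int (Suc n)) = 0"
    by (simp_all add: S_def lattice_paths_outside)
  have step: "(\<Sum>w\<in>lattice_paths (Suc n) (2 * int k - int (Suc n)). g (butlast w)) =
      S (int k - 1) + S (int k)" for k
    unfolding sum_lattice_paths_Suc S_def by (simp add: algebra_simps)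
  have "(\<Sum>k\<le>Suc n. (S (int k - 1) + S (int k)) / real (Suc n choose k)) =
      (\<Sum>k\<le>Suc n. S (int k - 1) / real (Suc n choose k)) +
      (\<Sum>k\<le>Suc n. S (int k) / real (Suc n choose k))"
    by (simp only: add_divide_distrib sum.distrib)
  \<comment> \<open>Index shift: a path with k + 1 up-steps that ends in an up-step has
    \<open>k\<close> of them before it.\<close>
  also have "(\<Sum>k\<le>Suc n. S (int k - 1) / real (Suc n choose k)) =
      (\<Sum>k\<le>n. S (int k) / real (Suc n choose Suc k))"
    unfolding sum.atMost_Suc_shift using S0 by simp
  also have "(\<Sum>k\<le>Suc n. S (int k) / real (Suc n choose k)) =
      (\<Sum>k\<le>n. S (int k) / real (Suc n choose k))"
    using S0 by simp
  finally have "(\<Sum>k\<le>Suc n. (S (int k - 1) + S (int k)) / real (Suc n choose k)) / real (n + 2) =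
      (\<Sum>k\<le>n. S (int k) * (1 / (real (n + 2) * real (Suc n choose Suc k)) +
         1 / (real (n + 2) * real (Suc n choose k))))"
    by (simp add: sum.distrib[symmetric] sum_divide_distrib add_divide_distrib distrib_left
        mult.commute del: binomial_Suc_Suc)
  also have "\<dots> = (\<Sum>k\<le>n. S (int k) / real (n choose k)) / real (n + 1)"
    unfolding sum_divide_distrib
    by (intro sum.cong refl, subst inverse_binomial_consistency) (simp_all add: field_simps)
  finally show ?thesis
    unfolding expectation_random_path step by (simp add: S_def del: binomial_Suc_Suc)
qed

text \<open>Only the class 2k = n contributes. It exists for even \<open>n\<close> only, all its
  paths end at height 0, and it has probability 1/(n+1).\<close>

lemma expectation_ends_at_zero:
  "measure_pmf.expectation (random_path n) (\<lambda>w. of_bool (snd (sum_list w) = 0)) =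
    of_bool (even n) / real (n + 1)"
proof -
  have "(\<Sum>w\<in>lattice_paths n (2 * int k - int n). of_bool (snd (sum_list w) = 0)) / real (n choose k) =
      (of_bool (2 * k = n) :: real)" if "k \<le> n" for k
  proof -
    have "(\<Sum>w\<in>lattice_paths n (2 * int k - int n). of_bool (snd (sum_list w) = 0)) =
        (\<Sum>w\<in>lattice_paths n (2 * int k - int n). of_bool (2 * k = n) :: real)"
      by (intro sum.cong refl) (auto simp: lattice_paths_def)
    then show ?thesis using that by (simp add: card_lattice_paths)
  qed
  moreover have "(\<Sum>k\<le>n. of_bool (2 * k = n)) = (of_bool (even n) :: real)"
  proof -
    have "{..n} \<inter> {k. 2 * k = n} = (if even n then {n div 2} else {})" by auto
    then show ?thesis by (simp add: sum.If_cases of_bool_def)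
  qed
  ultimately show ?thesis by (simp add: expectation_random_path)
qed

lemma path_points_snoc: "path_points (w @ [s]) = insert (sum_list (w @ [s])) (path_points w)"
  by (force simp: path_points_def le_Suc_eq)

text \<open>Each step moves one unit to the right, so the new endpoint lies strictly to the right of
  all earlier points and cannot repeat a zero already counted.\<close>

lemma num_zeros_snoc:
  assumes "set (w @ [s]) \<subseteq> {(1, 1), (1, -1)}"
  shows "num_zeros (w @ [s]) = num_zeros w + of_bool (snd (sum_list (w @ [s])) = 0)"
proof -
  let ?Z = "\<lambda>w. {x. (x, 0) \<in> path_points w}"
  \<comment> \<open>Needed for the cardinality of an \<open>insert\<close>, since
    \<open>card\<close> is 0 on infinite sets.\<close>
  have fin: "finite (?Z w)"
  proof (rule finite_subset)
    show "?Z w \<subseteq> (\<lambda>k. fst (sum_list (take k w))) ` {..length w}"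
    proof
      fix x assume "x \<in> ?Z w"
      then obtain k where k: "k \<le> length w" "(x, 0) = sum_list (take k w)"
        by (auto simp: path_points_def)
      show "x \<in> (\<lambda>k. fst (sum_list (take k w))) ` {..length w}"
      proof (rule image_eqI)
        show "x = fst (sum_list (take k w))" using k(2)[symmetric] by simp
      qed (use k(1) in simp)
    qed
  qed simp
  have le: "x \<le> int (length w)" if x: "x \<in> ?Z w" for x
  proof -
    obtain k where k: "k \<le> length w" "(x, 0) = sum_list (take k w)"
      using x by (auto simp: path_points_def)
    have "set (take k w) \<subseteq> {(1, 1), (1, -1)}"
      using assms set_take_subset[of k w] by auto
    then have "fst (sum_list (take k w)) = int k"
      using k(1) by (subst sum_list_steps) auto
    then show ?thesis using k by (metis fst_conv of_nat_le_iff)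
  qed
  have last: "fst (sum_list (w @ [s])) = int (Suc (length w))"
    using sum_list_steps(1)[OF assms] by simp
  have "?Z (w @ [s]) =
      (if snd (sum_list (w @ [s])) = 0 then insert (int (Suc (length w))) (?Z w) else ?Z w)"
    unfolding path_points_snoc using last
    by (cases "sum_list (w @ [s])") (auto simp del: sum_list_append)
  moreover have "int (Suc (length w)) \<notin> ?Z w" using le by fastforce
  ultimately show ?thesis using fin by (simp add: num_zeros_def)
qed

lemma set_random_path:
  "set_pmf (random_path n) = (\<Union>D\<in>endpoint_heights n. lattice_paths n D)"
  by (simp add: random_path_def endpoint_heights_finite_nonempty lattice_paths_finite
      lattice_paths_nonempty)

lemma expectation_num_zeros_Suc:
  "measure_pmf.expectation (random_path (Suc n)) (\<lambda>w. real (num_zeros w)) =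
    measure_pmf.expectation (random_path n) (\<lambda>w. real (num_zeros w)) +
    of_bool (odd n) / real (n + 2)"
proof -
  have int: "integrable (measure_pmf (random_path (Suc n))) f" for f :: "_ \<Rightarrow> real"
    by (rule integrable_measure_pmf_finite)
      (simp add: set_random_path endpoint_heights_finite_nonempty lattice_paths_finite)
  \<comment> \<open>Claimed on the support only, where \<open>w\<close> is nonempty and has
    admissible steps. Almost sure equality then suffices for the expectations.\<close>
  have "real (num_zeros w) =
      real (num_zeros (butlast w)) + of_bool (snd (sum_list w) = 0)"
    if "w \<in> set_pmf (random_path (Suc n))" for w
  proof -
    have w: "length w = Suc n" "set w \<subseteq> {(1, 1), (1, -1)}"
      using that by (auto simp: set_random_path lattice_paths_def)
    then obtain v s where "w = v @ [s]" by (cases w rule: rev_cases) auto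
    then show ?thesis using w num_zeros_snoc[of v s] by simp
  qed
  then have "measure_pmf.expectation (random_path (Suc n)) (\<lambda>w. real (num_zeros w)) =
      measure_pmf.expectation (random_path (Suc n))
        (\<lambda>w. real (num_zeros (butlast w)) + of_bool (snd (sum_list w) = 0))"
    by (intro integral_cong_AE) (auto simp: AE_measure_pmf_iff)
  also have "\<dots> = measure_pmf.expectation (random_path n) (\<lambda>w. real (num_zeros w)) +
      of_bool (odd n) / real (n + 2)"
    by (simp add: int expectation_random_path_butlast[of n "\<lambda>w. real (num_zeros w)"]
        expectation_ends_at_zero)
  finally show ?thesis .
qed

theorem theorem6p1:
  fixes n :: nat
  shows "measure_pmf.expectation (random_path n) (\<lambda>w. real (num_zeros w)) = H_odd (n + 1)"
proof (induction n)
  case 0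
  have "num_zeros [] = 1"
    by (simp add: num_zeros_def path_points_def zero_prod_def)
  then show ?case
    by (simp add: expectation_random_path lattice_paths_0 H_odd_def)
next
  case (Suc n)
  \<comment> \<open>The new summand of \<open>H_odd\<close> has j = n + 2, which is odd exactly when
    \<open>n\<close> is.\<close>
  then show ?case by (simp add: expectation_num_zeros_Suc H_odd_def)
qed

end
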